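(* A linear map $\varphi:(\mathbb{R}^{3},g_{Nil})\longrightarrow(\mathbb{R}^{3}, g_{Sol})$ from Nil space into Sol space with $$\varphi (X)=\begin{pmatrix} a_{11} & a_{12} & a_{13}\\ a_{21} & a_{22} & a_{23}\\ a_{31} & a_{32} & a_{33}\end{pmatrix}\begin{pmatrix}x\\ y\\ z\end{pmatrix},\qquad a_{ij}\in\mathbb{R},$$ is $\infty$-harmonic if and only if $\varphi$ takes one of the following forms (with arbitrary real entries $a_{ij}$ where indicated): $$\varphi (X)=\begin{pmatrix}0 & a_{12} & a_{13}\\ 0 & a_{22} & a_{23}\\ 0& 0 & 0\end{pmatrix}\begin{pmatrix}x\\ y\\ z\end{pmatrix},\qquad \varphi (X)=\begin{pmatrix}a_{11} & a_{12} & 0\\ a_{21} & a_{22} & 0\\ 0& 0 & 0\end{pmatrix}\begin{pmatrix}x\\ y\\ z\end{pmatrix},$$ $$\varphi (X)=\begin{pmatrix}0 & 0 & 0\\ 0 & 0 & 0\\ 0&a_{32}&a_{33}\end{pmatrix}\begin{pmatrix}x\\ y\\ z\end{pmatrix},\quad\text{or}\quad \varphi (X)=\begin{pmatrix}0 & 0 & 0\\ 0 & 0 & 0\\ a_{31}&a_{32}&0\end{pmatrix}\begin{pmatrix}x\\ y\\ z\end{pmatrix}.$$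
   Context: A smooth map $\varphi:(M,g)\to(N,h)$ between Riemannian manifolds is called $\infty$-harmonic if $\mathrm{d}\varphi(\mathrm{grad}\,|\mathrm{d}\varphi|^2)=0$ on $M$, where $|\mathrm{d}\varphi|^2=\mathrm{Trace}_g\,\varphi^*h$ is the energy density of $\varphi$ and $\mathrm{grad}$ is the gradient with respect to $g$. Nil space is $(\mathbb{R}^3,g_{Nil})$ and Sol space is $(\mathbb{R}^3,g_{Sol})$, where in the standard coordinates $(x,y,z)$ of $\mathbb{R}^3$: $g_{Nil}=\mathrm{d}x^2+\mathrm{d}y^2+(\mathrm{d}z-x\,\mathrm{d}y)^2$ and $g_{Sol}=e^{2z}\mathrm{d}x^2+e^{-2z}\mathrm{d}y^2+\mathrm{d}z^2$. A linear map means a map that is linear in these standard coordinates. *)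

theory Defs
  imports "HOL-Analysis.Analysis"
begin

text \<open>The manifolds are \<open>\<real>\<^sup>n\<close> with a single global chart. Every tangent space is identified
  with \<^typ>\<open>real ^ 'n\<close> through the standard coordinate fields, and a metric \<open>g\<close> sends a point
  \<open>p\<close> to the bilinear form \<open>g p\<close>.\<close>

type_synonym 'n metric = "real ^ 'n \<Rightarrow> real ^ 'n \<Rightarrow> real ^ 'n \<Rightarrow> real"

primrec C_k :: "nat \<Rightarrow> ('a::euclidean_space \<Rightarrow> 'b::euclidean_space) \<Rightarrow> bool" where
  "C_k 0 f \<longleftrightarrow> continuous_on UNIV f"
| "C_k (Suc k) f \<longleftrightarrow> (\<forall>p. f differentiable (at p)) \<and>
     (\<forall>v. C_k k (\<lambda>p. frechet_derivative f (at p) v))"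

definition smooth :: "('a::euclidean_space \<Rightarrow> 'b::euclidean_space) \<Rightarrow> bool" where
  "smooth f \<longleftrightarrow> (\<forall>k. C_k k f)"

definition riemannian_metric :: "'n::finite metric \<Rightarrow> bool" where
  "riemannian_metric g \<longleftrightarrow>
     (\<forall>p. bilinear (g p) \<and> (\<forall>v w. g p v w = g p w v) \<and> (\<forall>v. v \<noteq> 0 \<longrightarrow> g p v v > 0)) \<and>
     (\<forall>v w. smooth (\<lambda>p. g p v w))"

definition gram_matrix :: "(real ^ 'n \<Rightarrow> real ^ 'n \<Rightarrow> real) \<Rightarrow> real ^ 'n ^ 'n::finite" where
  "gram_matrix b = (\<chi> i j. b (axis i 1) (axis j 1))"

text \<open>The trace \<open>\<Sum>\<^sub>i\<^sub>j g\<^sup>i\<^sup>j b\<^sub>i\<^sub>j\<close> of a bilinear form \<open>b\<close> on the tangent space at \<open>p\<close>,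
  where \<open>(g\<^sup>i\<^sup>j)\<close> is the inverse of the coordinate matrix of \<open>g p\<close>.\<close>

definition metric_trace ::
    "'n::finite metric \<Rightarrow> real ^ 'n \<Rightarrow> (real ^ 'n \<Rightarrow> real ^ 'n \<Rightarrow> real) \<Rightarrow> real" where
  "metric_trace g p b =
     (\<Sum>i\<in>UNIV. \<Sum>j\<in>UNIV. matrix_inv (gram_matrix (g p)) $ i $ j * b (axis i 1) (axis j 1))"

definition pullback :: "(real ^ 'm \<Rightarrow> real ^ 'n) \<Rightarrow> 'n::finite metric \<Rightarrow> 'm::finite metric" where
  "pullback \<phi> h p v w =
     h (\<phi> p) (frechet_derivative \<phi> (at p) v) (frechet_derivative \<phi> (at p) w)"

definition energy_density ::
    "'m::finite metric \<Rightarrow> 'n::finite metric \<Rightarrow> (real ^ 'm \<Rightarrow> real ^ 'n) \<Rightarrow> real ^ 'm \<Rightarrow> real" where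
  "energy_density g h \<phi> p = metric_trace g p (pullback \<phi> h p)"

definition grad :: "'n::finite metric \<Rightarrow> (real ^ 'n \<Rightarrow> real) \<Rightarrow> real ^ 'n \<Rightarrow> real ^ 'n" where
  "grad g f p = (THE v. \<forall>w. g p v w = frechet_derivative f (at p) w)"

definition infinity_harmonic ::
    "'m::finite metric \<Rightarrow> 'n::finite metric \<Rightarrow> (real ^ 'm \<Rightarrow> real ^ 'n) \<Rightarrow> bool" where
  "infinity_harmonic g h \<phi> \<longleftrightarrow> smooth \<phi> \<and>
     (\<forall>p. frechet_derivative \<phi> (at p) (grad g (energy_density g h \<phi>) p) = 0)"

definition g_Nil :: "3 metric" where
  "g_Nil p v w = v$1 * w$1 + v$2 * w$2 + (v$3 - p$1 * v$2) * (w$3 - p$1 * w$2)"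

definition g_Sol :: "3 metric" where
  "g_Sol p v w = exp (2 * p$3) * (v$1 * w$1) + exp (- 2 * p$3) * (v$2 * w$2) + v$3 * w$3"

lemma has_derivative_nth: "((\<lambda>p::real^'n. p$i) has_derivative (\<lambda>v. v$i)) F"
  by (rule bounded_linear_imp_has_derivative) (rule bounded_linear_vec_nth)

lemma C_k_quadratic: "C_k k (\<lambda>p::real^3. a + b * p$1 + c * (p$1)^2)"
proof (induction k arbitrary: a b c)
  case 0
  show ?case by (auto intro!: continuous_intros)
next
  case (Suc k)
  have D: "((\<lambda>p::real^3. a + b * p$1 + c * (p$1)^2) has_derivative
      (\<lambda>v. b * v$1 + c * (2 * p$1 * v$1))) (at p)" for p
    by (auto intro!: derivative_eq_intros has_derivative_nth)
  have E: "frechet_derivative (\<lambda>p::real^3. a + b * p$1 + c * (p$1)^2) (at p) =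
      (\<lambda>v. b * v$1 + c * (2 * p$1 * v$1))" for p
    using frechet_derivative_at[OF D] by simp
  have "C_k k (\<lambda>p::real^3. b * v$1 + c * (2 * p$1 * v$1))" for v :: "real^3"
    using Suc[of "b * v$1" "2 * c * v$1" 0] by (simp add: algebra_simps)
  then show ?case using D by (auto simp: E differentiable_def)
qed

lemma C_k_exp: "C_k k (\<lambda>p::real^3. a * exp (2 * p$3) + b * exp (- 2 * p$3) + c)"
proof (induction k arbitrary: a b c)
  case 0
  show ?case by (auto intro!: continuous_intros)
next
  case (Suc k)
  let ?f = "\<lambda>p::real^3. a * exp (2 * p$3) + b * exp (- 2 * p$3) + c"
  let ?d = "\<lambda>(p::real^3) (v::real^3). 2 * a * v$3 * exp (2 * p$3) + (- 2 * b * v$3) * exp (- 2 * p$3) + 0"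
  have D: "(?f has_derivative ?d p) (at p)" for p
    by (auto intro!: derivative_eq_intros has_derivative_nth simp: algebra_simps)
  have E: "frechet_derivative ?f (at p) = ?d p" for p
    using frechet_derivative_at[OF D] by simp
  have "C_k k (\<lambda>p. ?d p v)" for v by (rule Suc)
  then show ?case using D unfolding C_k.simps E by (auto simp: differentiable_def)
qed

lemma riemannian_metric_Nil: "riemannian_metric g_Nil"
proof -
  have "bilinear (g_Nil p)" for p
    by (auto simp: bilinear_def g_Nil_def algebra_simps intro!: linearI)
  moreover have "g_Nil p v w = g_Nil p w v" for p v w by (simp add: g_Nil_def algebra_simps)
  moreover have "g_Nil p v v > 0" if "v \<noteq> 0" for p v
  proof -
    have "g_Nil p v v = (v$1)^2 + (v$2)^2 + (v$3 - p$1 * v$2)^2"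
      by (simp add: g_Nil_def power2_eq_square)
    moreover have "v$1 \<noteq> 0 \<or> v$2 \<noteq> 0 \<or> v$3 - p$1 * v$2 \<noteq> 0"
      using that by (auto simp: vec_eq_iff forall_3)
    ultimately show ?thesis
      by (smt (verit) zero_le_power2 zero_less_power2)
  qed
  moreover have "smooth (\<lambda>p. g_Nil p v w)" for v w
    unfolding smooth_def
  proof
    fix k
    have "(\<lambda>p. g_Nil p v w) = (\<lambda>p. (v$1 * w$1 + v$2 * w$2 + v$3 * w$3)
        + (- v$2 * w$3 - v$3 * w$2) * p$1 + (v$2 * w$2) * (p$1)^2)"
      by (auto simp: g_Nil_def algebra_simps power2_eq_square)
    then show "C_k k (\<lambda>p. g_Nil p v w)" by (simp only: C_k_quadratic)
  qed
  ultimately show ?thesis unfolding riemannian_metric_def by blast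
qed

lemma riemannian_metric_Sol: "riemannian_metric g_Sol"
proof -
  have "bilinear (g_Sol p)" for p
    by (auto simp: bilinear_def g_Sol_def algebra_simps intro!: linearI)
  moreover have "g_Sol p v w = g_Sol p w v" for p v w by (simp add: g_Sol_def algebra_simps)
  moreover have "g_Sol p v v > 0" if "v \<noteq> 0" for p v
  proof -
    have "g_Sol p v v = exp (2 * p$3) * (v$1)^2 + exp (- 2 * p$3) * (v$2)^2 + (v$3)^2"
      by (simp add: g_Sol_def power2_eq_square)
    moreover have "v$1 \<noteq> 0 \<or> v$2 \<noteq> 0 \<or> v$3 \<noteq> 0"
      using that by (auto simp: vec_eq_iff forall_3)
    moreover have "exp (2 * p$3) * (v$1)^2 \<ge> 0" "exp (- 2 * p$3) * (v$2)^2 \<ge> 0" "(v$3)^2 \<ge> 0"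
      by auto
    moreover have "v$1 \<noteq> 0 \<Longrightarrow> exp (2 * p$3) * (v$1)^2 > 0"
      "v$2 \<noteq> 0 \<Longrightarrow> exp (- 2 * p$3) * (v$2)^2 > 0" "v$3 \<noteq> 0 \<Longrightarrow> (v$3)^2 > 0"
      by auto
    ultimately show ?thesis by linarith
  qed
  moreover have "smooth (\<lambda>p. g_Sol p v w)" for v w
    unfolding smooth_def
  proof
    fix k
    have "(\<lambda>p. g_Sol p v w) = (\<lambda>p. (v$1 * w$1) * exp (2 * p$3)
        + (v$2 * w$2) * exp (- 2 * p$3) + v$3 * w$3)"
      by (auto simp: g_Sol_def algebra_simps)
    then show "C_k k (\<lambda>p. g_Sol p v w)" by (simp only: C_k_exp)
  qed
  ultimately show ?thesis unfolding riemannian_metric_def by blast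
qed

end

theory Submission imports Defs begin

text \<open>The energy density of the linear map with matrix \<open>A\<close> is \<open>e\<^bsup>2w\<^esup> N\<^sub>1(x) + e\<^bsup>-2w\<^esup> N\<^sub>2(x) + N\<^sub>3(x)\<close>,
  where \<open>w\<close> is the third component of the map and \<open>N\<^sub>i\<close> is the squared norm of its \<open>i\<close>-th
  row in the orthonormal frame \<open>\<partial>\<^sub>x, \<partial>\<^sub>y + x\<partial>\<^sub>z, \<partial>\<^sub>z\<close> of Nil. If the third row vanishes, the equation is
  polynomial in \<open>x\<close>. Otherwise, if \<open>w\<close> depends on \<open>y\<close> or \<open>z\<close>, then \<open>w\<close> and \<open>x\<close> vary
  independently, and the coefficients of \<open>e\<^bsup>2w\<^esup>\<close> and \<open>e\<^bsup>-2w\<^esup>\<close> in the third component of the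
  equation vanish; evaluating them where \<open>N\<^sub>i' = 0\<close> kills the first two rows. If
  \<open>w\<close> is a nonzero multiple of \<open>x\<close>, the energy density is constant, and the
  growth of the exponentials kills them again.\<close>

section \<open>Smoothness and derivatives of linear maps\<close>

lemma C_k_const: "C_k k (\<lambda>p::'a::euclidean_space. c::'b::euclidean_space)"
proof (induction k arbitrary: c)
  case (Suc k)
  then show ?case
    by simp
qed simp

lemma frechet_derivative_linear:
  fixes f :: "'a::euclidean_space \<Rightarrow> 'b::euclidean_space"
  assumes "linear f"
  shows "frechet_derivative f (at p) = f"
  using frechet_derivative_at[OF linear_imp_has_derivative[OF assms]] by simp

lemma smooth_linear:
  fixes f :: "'a::euclidean_space \<Rightarrow> 'b::euclidean_space"
  assumes "linear f"
  shows "smooth f"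
  unfolding smooth_def
proof
  fix k
  show "C_k k f"
  proof (cases k)
    case 0
    then show ?thesis using assms by (simp add: linear_continuous_on linear_conv_bounded_linear)
  next
    case (Suc m)
    then show ?thesis
      using linear_imp_differentiable[OF assms]
      by (simp add: frechet_derivative_linear[OF assms] C_k_const)
  qed
qed

section \<open>Trace and gradient of the Nil metric\<close>

lemma matrix_inv_eqI:
  fixes A B :: "real^'n^'n"
  assumes "A ** B = mat 1"
  shows "matrix_inv A = B"
proof -
  have "matrix_inv A ** A = mat 1"
    using assms matrix_left_right_inverse someI[of "\<lambda>B. A ** B = mat 1 \<and> B ** A = mat 1"]
    unfolding matrix_inv_def by blast
  then show ?thesis
    using assms by (metis matrix_mul_assoc matrix_mul_lid matrix_mul_rid)
qed

lemma matrix_inv_gram_Nil: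
  "matrix_inv (gram_matrix (g_Nil p)) =
    vector [vector [1, 0, 0], vector [0, 1, p$1], vector [0, p$1, 1 + (p$1)^2]]"
  by (rule matrix_inv_eqI)
    (simp add: vec_eq_iff forall_3 matrix_matrix_mult_def sum_3 gram_matrix_def g_Nil_def
      axis_def mat_def power2_eq_square algebra_simps)

lemma metric_trace_Nil:
  "metric_trace g_Nil p b =
    b (axis 1 1) (axis 1 1) + b (axis 2 1) (axis 2 1)
    + p$1 * (b (axis 2 1) (axis 3 1) + b (axis 3 1) (axis 2 1))
    + (1 + (p$1)^2) * b (axis 3 1) (axis 3 1)"
  by (simp add: metric_trace_def matrix_inv_gram_Nil sum_3 algebra_simps)

text \<open>The components are the inverse Gram matrix applied to the differential. Positive
  definiteness gives the uniqueness that \<open>THE\<close> requires.\<close>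

lemma grad_Nil:
  assumes D: "(f has_derivative D) (at p)"
  shows "grad g_Nil f p =
    vector [D (axis 1 1), D (axis 2 1) + p$1 * D (axis 3 1),
      p$1 * D (axis 2 1) + (1 + (p$1)^2) * D (axis 3 1)]"
    (is "_ = ?G")
  unfolding grad_def
proof (rule the_equality)
  have lin: "linear D" using D by (rule has_derivative_linear)
  have Dw: "D w = w$1 * D (axis 1 1) + w$2 * D (axis 2 1) + w$3 * D (axis 3 1)" for w
  proof -
    have "w = w$1 *\<^sub>R axis 1 1 + w$2 *\<^sub>R axis 2 1 + w$3 *\<^sub>R axis 3 1"
      by (simp add: vec_eq_iff forall_3 axis_def)
    then have "D w = D (w$1 *\<^sub>R axis 1 1 + w$2 *\<^sub>R axis 2 1 + w$3 *\<^sub>R axis 3 1)"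
      by (rule arg_cong)
    then show ?thesis by (simp only: linear_add[OF lin] linear_scale[OF lin] real_scaleR_def)
  qed
  have F: "frechet_derivative f (at p) = D"
    using frechet_derivative_at[OF D] by simp
  show G: "\<forall>w. g_Nil p ?G w = frechet_derivative f (at p) w"
    unfolding F
  proof
    fix w
    show "g_Nil p ?G w = D w"
      by (subst (4) Dw) (simp add: g_Nil_def power2_eq_square algebra_simps)
  qed
  fix v assume v: "\<forall>w. g_Nil p v w = frechet_derivative f (at p) w"
  have "g_Nil p (v - ?G) w = g_Nil p v w - g_Nil p ?G w" for w
    by (simp add: g_Nil_def algebra_simps)
  then have "g_Nil p (v - ?G) (v - ?G) = 0" using v G by simp
  then show "v = ?G"
    using riemannian_metric_Nil unfolding riemannian_metric_def
    by (metis less_irrefl right_minus_eq)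
qed

section \<open>The energy density of a linear map and the resulting equations\<close>

text \<open>This is \<open>N\<^sub>i\<close>; the squared terms are the values of row
  \<open>i\<close> on the three frame fields.\<close>

definition row_energy :: "real^3^3 \<Rightarrow> 3 \<Rightarrow> real \<Rightarrow> real" where
  "row_energy A i x = (A$i$1)^2 + (A$i$2 + x * A$i$3)^2 + (A$i$3)^2"

definition row_energy_deriv :: "real^3^3 \<Rightarrow> 3 \<Rightarrow> real \<Rightarrow> real" where
  "row_energy_deriv A i x = 2 * A$i$3 * (A$i$2 + x * A$i$3)"

lemma has_real_derivative_row_energy:
  "(row_energy A i has_real_derivative row_energy_deriv A i x) (at x)"
  unfolding row_energy_def[abs_def] row_energy_deriv_def
  by (auto intro!: derivative_eq_intros)

lemma energy_density_linear:
  fixes A :: "real^3^3"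
  shows "energy_density g_Nil g_Sol ((*v) A) p =
    exp (2 * (A *v p)$3) * row_energy A 1 (p$1)
    + exp (- 2 * (A *v p)$3) * row_energy A 2 (p$1) + row_energy A 3 (p$1)"
proof -
  have ax: "(A *v axis j 1)$i = A$i$j" for i j
    by (simp add: matrix_vector_mul_component inner_axis)
  show ?thesis
    by (simp add: energy_density_def metric_trace_Nil pullback_def g_Sol_def
        frechet_derivative_linear ax row_energy_def power2_eq_square algebra_simps)
qed

text \<open>Half the derivative of the energy density with respect to \<open>w\<close> at fixed
  \<open>x\<close>.\<close>

definition sol_defect :: "real^3^3 \<Rightarrow> real^3 \<Rightarrow> real" where
  "sol_defect A p = exp (2 * (A *v p)$3) * row_energy A 1 (p$1)
    - exp (- 2 * (A *v p)$3) * row_energy A 2 (p$1)"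

definition energy_dx :: "real^3^3 \<Rightarrow> real^3 \<Rightarrow> real" where
  "energy_dx A p = 2 * A$3$1 * sol_defect A p
    + exp (2 * (A *v p)$3) * row_energy_deriv A 1 (p$1)
    + exp (- 2 * (A *v p)$3) * row_energy_deriv A 2 (p$1) + row_energy_deriv A 3 (p$1)"

lemma energy_density_has_derivative:
  fixes A :: "real^3^3"
  shows "(energy_density g_Nil g_Sol ((*v) A) has_derivative
    (\<lambda>v. energy_dx A p * v$1 + 2 * sol_defect A p * (A$3$2 * v$2 + A$3$3 * v$3))) (at p)"
proof -
  have N: "((\<lambda>p. row_energy A i (p$1)) has_derivative (\<lambda>v. row_energy_deriv A i (p$1) * v$1)) (at p)"
    for i
    using has_derivative_compose[OF has_derivative_nth
        has_real_derivative_row_energy[unfolded has_field_derivative_def]] .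
  have W: "((\<lambda>p. (A *v p)$3) has_derivative (\<lambda>v. (A *v v)$3)) (at p)"
    using has_derivative_compose[OF linear_imp_has_derivative[OF matrix_vector_mul_linear]
        has_derivative_nth] .
  have Av: "(A *v v)$3 = A$3$1 * v$1 + A$3$2 * v$2 + A$3$3 * v$3" for v
    by (simp add: matrix_vector_mult_def sum_3)
  show ?thesis
    unfolding energy_density_linear[abs_def]
    by (rule has_derivative_eq_rhs, (rule derivative_intros N W)+)
      (simp add: fun_eq_iff energy_dx_def sol_defect_def Av algebra_simps)
qed

text \<open>The coefficient of \<open>sol_defect\<close> is the contribution of the derivatives of the energy along
  \<open>\<partial>\<^sub>y + x\<partial>\<^sub>z\<close> and \<open>\<partial>\<^sub>z\<close>.\<close>

lemma infinity_harmonic_linear_iff: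
  fixes A :: "real^3^3"
  shows "infinity_harmonic g_Nil g_Sol ((*v) A) \<longleftrightarrow>
    (\<forall>p i. A$i$1 * energy_dx A p + 2 * sol_defect A p *
      ((A$3$2 + p$1 * A$3$3) * (A$i$2 + p$1 * A$i$3) + A$3$3 * A$i$3) = 0)"
proof -
  have "(A *v grad g_Nil (energy_density g_Nil g_Sol ((*v) A)) p)$i =
    A$i$1 * energy_dx A p + 2 * sol_defect A p *
      ((A$3$2 + p$1 * A$3$3) * (A$i$2 + p$1 * A$i$3) + A$3$3 * A$i$3)" for p i
    unfolding grad_Nil[OF energy_density_has_derivative]
    by (simp add: matrix_vector_mult_def sum_3 axis_def power2_eq_square algebra_simps)
  then show ?thesis
    unfolding infinity_harmonic_def
    by (simp add: smooth_linear frechet_derivative_linear vec_eq_iff)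
qed

section \<open>A nonzero third row forces the other two rows to vanish\<close>

lemma row_energy_ge: "row_energy A i x \<ge> (A$i$1)^2 + (A$i$3)^2"
  by (simp add: row_energy_def)

lemma row_energy_pos:
  assumes "A$i \<noteq> 0"
  shows "row_energy A i x > 0"
proof (rule ccontr)
  assume "\<not> row_energy A i x > 0"
  then have "(A$i$1)^2 + (A$i$2 + x * A$i$3)^2 + (A$i$3)^2 = 0"
    unfolding row_energy_def by (smt (verit) zero_le_power2)
  then have "A$i$1 = 0 \<and> A$i$2 + x * A$i$3 = 0 \<and> A$i$3 = 0"
    by (smt (verit) zero_le_power2 zero_less_power2)
  then show False using assms by (auto simp: vec_eq_iff forall_3)
qed

lemma row_energy_nonneg: "row_energy A i x \<ge> 0"
  by (simp add: row_energy_def)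

text \<open>Multiplication by \<open>u = exp (2 * t)\<close> gives a polynomial of degree at most
  two in \<open>u\<close>, and three of its roots already make it zero.\<close>

lemma exp_coeffs_zero:
  fixes a b c :: real
  assumes "\<And>t. a * exp (2 * t) + b * exp (- 2 * t) + c = 0"
  shows "a = 0" "b = 0"
proof -
  have eq: "a * u^2 + c * u + b = 0" if "u > 0" for u
  proof -
    have "u * (a * u + b / u + c) = 0"
      using assms[of "ln u / 2"] that by (simp add: exp_minus field_simps)
    then have "a * u + b / u + c = 0" using that by simp
    then show ?thesis using that by (simp add: field_simps power2_eq_square)
  qed
  from eq[of 1] eq[of 2] eq[of 3] show "a = 0" "b = 0" by simp_all
qed

text \<open>At a zero of \<open>N\<^sub>i'\<close> the hypothesis reads \<open>N\<^sub>i r = 0\<close>.\<close>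

lemma row_zero_if_log_deriv:
  assumes eq: "\<And>x. 2 * row_energy A i x * r x = c * row_energy_deriv A i x"
    and r: "\<And>x. r x > 0"
  shows "A$i = 0"
proof (rule ccontr)
  assume ne: "A$i \<noteq> 0"
  \<comment> \<open>The energy of a row is either constant in \<open>x\<close> or a parabola with a
    vertex.\<close>
  have "\<exists>x. row_energy_deriv A i x = 0"
  proof (cases "A$i$3 = 0")
    case False
    then have "row_energy_deriv A i (- A$i$2 / A$i$3) = 0"
      by (simp add: row_energy_deriv_def)
    then show ?thesis ..
  qed (simp add: row_energy_deriv_def)
  then obtain x where "row_energy_deriv A i x = 0" ..
  then have "row_energy A i x * r x = 0" using eq[of x] by simp
  then show False using r[of x] row_energy_pos[OF ne, of x] by simp
qed

text \<open>Since the exponential is unbounded, the only nonnegative lower bound of the row energy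
  is 0. This kills the outer entries first; then the energy is the constant
  \<open>(A$i$2)^2\<close>, its own lower bound.\<close>

lemma row_zero_if_exp_bounded:
  assumes c: "c \<noteq> 0" and bd: "\<And>x. exp (2 * c * x) * row_energy A i x \<le> k"
  shows "A$i = 0"
proof -
  have lower_zero: "m = 0" if m: "m \<ge> 0" "\<And>x. row_energy A i x \<ge> m" for m
  proof (rule ccontr)
    assume "m \<noteq> 0"
    with m have mpos: "m > 0" by simp
    \<comment> \<open>Chosen so that \<open>(1 + t) * m = m + \<bar>k\<bar>\<close> exceeds
      \<open>k\<close>; the point \<open>t / (2 * c)\<close> serves either sign of
      \<open>c\<close>.\<close>
    define t where "t = \<bar>k\<bar> / m"
    have "(1 + t) * m \<le> exp t * m"
      using mpos by (intro mult_right_mono) auto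
    also have "\<dots> \<le> exp t * row_energy A i (t / (2 * c))"
      using m by (intro mult_left_mono) auto
    also have "\<dots> \<le> k" using bd[of "t / (2 * c)"] c by simp
    finally have "m + \<bar>k\<bar> \<le> k" using mpos by (simp add: t_def distrib_right)
    then show False using mpos by linarith
  qed
  have "(A$i$1)^2 + (A$i$3)^2 = 0"
    by (rule lower_zero) (simp_all add: row_energy_ge)
  then have z: "A$i$1 = 0" "A$i$3 = 0" by (simp_all add: sum_power2_eq_zero_iff)
  then have "(A$i$2)^2 = 0"
    by (intro lower_zero) (simp_all add: row_energy_def)
  with z show ?thesis by (simp add: vec_eq_iff forall_3)
qed

lemma rows_zero_if_third_row_nonzero:
  assumes ih: "infinity_harmonic g_Nil g_Sol ((*v) A)" and ne: "A$3 \<noteq> 0"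
  shows "A$1 = 0 \<and> A$2 = 0"
proof -
  let ?w = "\<lambda>p. (A *v p)$3"
  have w: "?w p = A$3$1 * p$1 + A$3$2 * p$2 + A$3$3 * p$3" for p
    by (simp add: matrix_vector_mult_def sum_3)
  \<comment> \<open>The \<open>sol_defect\<close> part of \<open>energy_dx\<close> supplies the term
    \<open>(A$3$1)^2\<close> that completes \<open>row_energy A 3\<close>.\<close>
  have third: "2 * sol_defect A p * row_energy A 3 (p$1) + A$3$1 *
      (exp (2 * ?w p) * row_energy_deriv A 1 (p$1)
       + exp (- 2 * ?w p) * row_energy_deriv A 2 (p$1) + row_energy_deriv A 3 (p$1)) = 0" for p
    using ih[unfolded infinity_harmonic_linear_iff, rule_format, of 3 p]
    by (simp add: energy_dx_def row_energy_def power2_eq_square algebra_simps)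
  show ?thesis
  proof (cases "A$3$2 = 0 \<and> A$3$3 = 0")
    case False
    have "2 * row_energy A 1 x * row_energy A 3 x + A$3$1 * row_energy_deriv A 1 x = 0 \<and>
      A$3$1 * row_energy_deriv A 2 x - 2 * row_energy A 2 x * row_energy A 3 x = 0"
      (is "?a = 0 \<and> ?b = 0") for x
    proof -
      have "?a * exp (2 * t) + ?b * exp (- 2 * t) + A$3$1 * row_energy_deriv A 3 x = 0" for t
      proof -
        \<comment> \<open>The amount that \<open>y\<close> and \<open>z\<close> must contribute for
          \<open>w\<close> to equal \<open>t\<close> at the given \<open>x\<close>.\<close>
        let ?s = "t - A$3$1 * x"
        obtain y z where yz: "A$3$2 * y + A$3$3 * z = ?s"
        proof (cases "A$3$2 = 0")
          case True
          with False show ?thesis using that[of 0 "?s / A$3$3"] by simp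
        next
          case False
          then show ?thesis using that[of "?s / A$3$2" 0] by simp
        qed
        define p :: "real^3" where "p = vector [x, y, z]"
        have p: "p$1 = x" "?w p = t" using yz by (simp_all add: w p_def)
        show ?thesis
          using third[of p] by (simp add: sol_defect_def p algebra_simps)
      qed
      from exp_coeffs_zero[OF this] show ?thesis by simp
    qed
    note ab = this
    have "A$1 = 0"
      by (rule row_zero_if_log_deriv[where r = "row_energy A 3" and c = "- A$3$1"])
        (use ab row_energy_pos[OF ne] in \<open>auto simp: algebra_simps add_eq_0_iff\<close>)
    moreover have "A$2 = 0"
      by (rule row_zero_if_log_deriv[where r = "row_energy A 3" and c = "A$3$1"])
        (use ab row_energy_pos[OF ne] in \<open>auto simp: algebra_simps\<close>)
    ultimately show ?thesis ..
  next
    case True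
    define c where "c = A$3$1"
    have c: "c \<noteq> 0" using True ne by (auto simp: c_def vec_eq_iff forall_3)
    \<comment> \<open>Along the \<open>x\<close>-axis this is the energy density without its
      third-row term, which is constant in this case.\<close>
    define f where
      "f x = exp (2 * c * x) * row_energy A 1 x + exp (- 2 * c * x) * row_energy A 2 x" for x
    have "(f has_real_derivative 0) (at x)" for x
    proof -
      define p :: "real^3" where "p = vector [x, 0, 0]"
      have p: "p$1 = x" "?w p = c * x" by (simp_all add: p_def w c_def)
      have "energy_dx A p = 0"
        using ih[unfolded infinity_harmonic_linear_iff, rule_format, of 3 p] True c
        by (simp add: c_def)
      then have z: "2 * c * sol_defect A p + exp (2 * c * x) * row_energy_deriv A 1 x
          + exp (- 2 * c * x) * row_energy_deriv A 2 x = 0"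
        using True by (simp add: energy_dx_def p row_energy_deriv_def[of A 3] c_def[symmetric] mult.assoc)
      show ?thesis
        unfolding f_def[abs_def]
        by (rule derivative_eq_intros has_real_derivative_row_energy refl)+
          (use z in \<open>simp add: sol_defect_def p algebra_simps\<close>)
    qed
    then have f: "f x = f 0" for x by (intro DERIV_isconst_all) auto
    \<comment> \<open>Both summands of the constant \<open>f\<close> are nonnegative, so each is
      bounded by \<open>f 0\<close>.\<close>
    have "A$1 = 0"
    proof (rule row_zero_if_exp_bounded[OF c])
      show "exp (2 * c * x) * row_energy A 1 x \<le> f 0" for x
        using f[of x] mult_nonneg_nonneg[OF exp_ge_zero row_energy_nonneg, of "- 2 * c * x" A 2 x]
        unfolding f_def[of x] by linarith
    qed
    moreover have "A$2 = 0"
    proof (rule row_zero_if_exp_bounded[of "- c"])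
      show "exp (2 * - c * x) * row_energy A 2 x \<le> f 0" for x
        using f[of x] mult_nonneg_nonneg[OF exp_ge_zero row_energy_nonneg, of "2 * c * x" A 1 x]
        unfolding f_def[of x] by simp
    qed (use c in simp)
    ultimately show ?thesis ..
  qed
qed

section \<open>The two remaining cases and the classification\<close>

text \<open>The equations reduce to \<open>A$i$1 * energy_dx A p = 0\<close>. So the first column
  vanishes or \<open>energy_dx\<close>, affine in \<open>x\<close>, is identically zero; its slope
  is a sum of squares.\<close>

lemma infinity_harmonic_third_row_zero_iff:
  assumes z: "A$3 = 0"
  shows "infinity_harmonic g_Nil g_Sol ((*v) A) \<longleftrightarrow>
    A$1$1 = 0 \<and> A$2$1 = 0 \<or> A$1$3 = 0 \<and> A$2$3 = 0"
proof -
  have w: "(A *v p)$3 = 0" for p using z by (simp add: matrix_vector_mult_def)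
  have dx: "energy_dx A p = 2 * (A$1$3 * A$1$2 + A$2$3 * A$2$2)
      + 2 * p$1 * ((A$1$3)^2 + (A$2$3)^2)" for p
    using z by (simp add: energy_dx_def w row_energy_deriv_def power2_eq_square algebra_simps)
  have "A$1$3 = 0 \<and> A$2$3 = 0" if dx0: "\<And>p. energy_dx A p = 0"
  proof -
    have "2 * ((A$1$3)^2 + (A$2$3)^2) = 0"
      \<comment> \<open>The values at \<open>x = 0\<close> and \<open>x = 1\<close> differ by the
        slope.\<close>
      using dx0[of 0] dx0[of "vector [1, 0, 0]"] unfolding dx by simp
    then show ?thesis by (simp add: sum_power2_eq_zero_iff del: distrib_left_numeral)
  qed
  then show ?thesis
    unfolding infinity_harmonic_linear_iff using z by (auto simp: forall_3 dx)
qed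

text \<open>Only \<open>A$3$1 * energy_dx A p = 0\<close> survives, and \<open>energy_dx\<close> is
  affine in \<open>x\<close> with slope \<open>2 * (A$3$3)^2\<close>.\<close>

lemma infinity_harmonic_third_row_iff:
  assumes z: "A$1 = 0" "A$2 = 0"
  shows "infinity_harmonic g_Nil g_Sol ((*v) A) \<longleftrightarrow> A$3$1 = 0 \<or> A$3$3 = 0"
proof -
  have s: "sol_defect A p = 0" for p using z by (simp add: sol_defect_def row_energy_def)
  have dx: "energy_dx A p = 2 * A$3$3 * (A$3$2 + p$1 * A$3$3)" for p
    using z by (simp add: energy_dx_def s row_energy_deriv_def)
  have "A$3$3 = 0" if dx0: "\<And>p. energy_dx A p = 0"
    using dx0[of 0] dx0[of "vector [1, 0, 0]"] by (auto simp: dx)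
  then show ?thesis
    unfolding infinity_harmonic_linear_iff using z by (auto simp: forall_3 dx s)
qed

lemma infinity_harmonic_linear_classification:
  "infinity_harmonic g_Nil g_Sol ((*v) A) \<longleftrightarrow>
    A$3 = 0 \<and> (A$1$1 = 0 \<and> A$2$1 = 0 \<or> A$1$3 = 0 \<and> A$2$3 = 0) \<or>
    A$1 = 0 \<and> A$2 = 0 \<and> (A$3$1 = 0 \<or> A$3$3 = 0)"
  using rows_zero_if_third_row_nonzero infinity_harmonic_third_row_zero_iff
    infinity_harmonic_third_row_iff by blast

theorem theorem3p1:
  fixes \<phi> :: "real ^ 3 \<Rightarrow> real ^ 3"
    and a11 a12 a13 a21 a22 a23 a31 a32 a33 :: real
  assumes "\<And>X. \<phi> X = (vector [vector [a11, a12, a13],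
                              vector [a21, a22, a23],
                              vector [a31, a32, a33]] :: real ^ 3 ^ 3) *v X"
  shows "infinity_harmonic g_Nil g_Sol \<phi> \<longleftrightarrow>
      (\<exists>b12 b13 b22 b23 :: real. \<forall>X. \<phi> X =
         (vector [vector [0, b12, b13],
                  vector [0, b22, b23],
                  vector [0, 0, 0]] :: real ^ 3 ^ 3) *v X)
    \<or> (\<exists>b11 b12 b21 b22 :: real. \<forall>X. \<phi> X =
         (vector [vector [b11, b12, 0],
                  vector [b21, b22, 0],
                  vector [0, 0, 0]] :: real ^ 3 ^ 3) *v X)
    \<or> (\<exists>b32 b33 :: real. \<forall>X. \<phi> X =
         (vector [vector [0, 0, 0],
                  vector [0, 0, 0],
                  vector [0, b32, b33]] :: real ^ 3 ^ 3) *v X)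
    \<or> (\<exists>b31 b32 :: real. \<forall>X. \<phi> X =
         (vector [vector [0, 0, 0],
                  vector [0, 0, 0],
                  vector [b31, b32, 0]] :: real ^ 3 ^ 3) *v X)"
proof -
  define A :: "real^3^3" where
    "A = vector [vector [a11, a12, a13], vector [a21, a22, a23], vector [a31, a32, a33]]"
  have \<phi>: "\<phi> = (*v) A" using assms by (simp add: A_def fun_eq_iff)
  \<comment> \<open>A matrix is determined by its linear map, so each listed form becomes a
    condition on the entries of \<open>A\<close>.\<close>
  have eq: "(\<forall>X. \<phi> X = B *v X) \<longleftrightarrow> A = B" for B
    unfolding \<phi> by (metis matrix_eq)
  show ?thesis
    unfolding eq unfolding \<phi> infinity_harmonic_linear_classification
    by (auto simp: A_def vec_eq_iff forall_3)
qed

end
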